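(* Let $K$ be a field of characteristic $0$, $X=\{x\}$, $A=K\{X\}$ (or $A=K\{\{X\}\}$), and let $A_0=\{a\in A:\frac{d}{dx}a=0\}$. A vector space basis of $A_0$ is given by the homogeneous polynomials $\Phi(s)$, $s\in\Gamma$. The dimension of $(A_0)_n$ is given by $c_n-c_{n-1}$, where the $c_n:=\frac{(2(n-1))!}{n!(n-1)!}$ are the Catalan numbers.
   Context: $M=M(x)$ is the free magma (without unit) on one generator $x$ (planar binary rooted trees), $\deg$ the number of leaves. $K\{X\}$ is the free unital, not necessarily associative, $K$-algebra on $x$, with basis $M\cup\{1\}$, graded by $\deg$, and $K\{\{X\}\}=\prod_n K\{X\}_n$ is its completion. $\frac{d}{dx}$ is the $K$-linear derivation of $A$ with $\frac{d}{dx}x=1$. $(A_0)_n$ is the space of elements of $A_0$ homogeneous of degree $n$. Every $f\in A$ has a unique Taylor expansion $f=\sum_{j=0}^{\infty}x^j.a_j(f)$ with $a_j(f)\in A_0$, where $x^j.g=L^j(g)$ and $L(g)=x\cdot g$; one sets $\Phi(f)=a_0(f)$. $\Gamma=M-(xM\cup\{x\})$, where $xM=\{x\cdot t:t\in M\}$.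
   Formalization: As 1 lies in A_0 but not in the span of Φ(Γ), the basis proved is Φ(s), s∈Γ, together with Φ(1)=1; for K{{X}}, where no countable vector space basis exists, it is a basis for infinite sums; the dimension formula is for n≥1 with c_0:=1. *)

theory Defs
  imports Complex_Main
begin

text \<open>The free magma on one generator: planar binary rooted trees.\<close>

datatype magma = X | Mul magma magma  (infixl "\<bullet>" 70)

primrec deg :: "magma \<Rightarrow> nat" where
  "deg X = 1"
| "deg (u \<bullet> v) = deg u + deg v"

text \<open>The basis of the free unital algebra is the magma with a unit adjoined: \<^term>\<open>None\<close>
  stands for the unit and \<^term>\<open>Some t\<close> for the tree \<^term>\<open>t\<close>.\<close>

type_synonym word = "magma option"

fun wmul :: "word \<Rightarrow> word \<Rightarrow> word" where
  "wmul None q = q"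
| "wmul p None = p"
| "wmul (Some u) (Some v) = Some (u \<bullet> v)"

primrec wdeg :: "word \<Rightarrow> nat" where
  "wdeg None = 0"
| "wdeg (Some t) = deg t"

text \<open>Non-associative formal power series in one variable.  There are only finitely many words
  of each degree, so the completion, that is the product of the homogeneous components, consists
  of all coefficient functions.  The polynomials are the series of finite support.\<close>

typedef 'k nas = "UNIV :: (word \<Rightarrow> 'k) set"
  morphisms coeff Series
  by simp

lemma coeff_Series [simp]: "coeff (Series f) = f"
  by (simp add: Series_inverse)

lemma nas_eqI: "(\<And>b. coeff f b = coeff g b) \<Longrightarrow> f = g"
  by (metis coeff_inject ext)

instantiation nas :: (ab_group_add) ab_group_add
begin
definition "0 = Series (\<lambda>b. 0)"
definition "f + g = Series (\<lambda>b. coeff f b + coeff g b)"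
definition "- f = Series (\<lambda>b. - coeff f b)"
definition "f - g = Series (\<lambda>b. coeff f b - coeff g b)"
instance
  by standard
    (auto intro!: nas_eqI simp: zero_nas_def plus_nas_def uminus_nas_def minus_nas_def algebra_simps)
end

lemma coeff_zero [simp]: "coeff 0 b = 0"
  and coeff_plus [simp]: "coeff (f + g) b = coeff f b + coeff g b"
  and coeff_uminus [simp]: "coeff (- f) b = - coeff f b"
  and coeff_minus [simp]: "coeff (f - g) b = coeff f b - coeff g b"
  by (simp_all add: zero_nas_def plus_nas_def uminus_nas_def minus_nas_def)

lemma coeff_sum [simp]: "coeff (sum F S) b = (\<Sum>s\<in>S. coeff (F s) b)"
  by (induction S rule: infinite_finite_induct) auto

definition monom :: "word \<Rightarrow> 'k::zero_neq_one nas" where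
  "monom b = Series (\<lambda>t. if t = b then 1 else 0)"

lemma coeff_monom: "coeff (monom b) t = (if t = b then 1 else 0)"
  by (simp add: monom_def)

text \<open>The sum in the product runs over the finite set of factorisations of \<^term>\<open>b\<close>,
  cf. \<open>factorisations\<close> below.\<close>

instantiation nas :: (field) "{one, times}"
begin
definition "1 = monom None"
definition "f * g = Series (\<lambda>b. \<Sum>(p, q) | wmul p q = b. coeff f p * coeff g q)"
instance ..
end

definition scale :: "'k::field \<Rightarrow> 'k nas \<Rightarrow> 'k nas" where
  "scale c f = Series (\<lambda>b. c * coeff f b)"

lemma coeff_scale [simp]: "coeff (scale c f) b = c * coeff f b"
  by (simp add: scale_def)

interpretation nas: vector_space "scale :: 'k::field \<Rightarrow> 'k nas \<Rightarrow> 'k nas"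
  by standard (auto intro!: nas_eqI simp: algebra_simps)

definition polys :: "'k::zero nas set" where
  "polys = {f. finite {b. coeff f b \<noteq> 0}}"

definition homogeneous :: "nat \<Rightarrow> 'k::zero nas set" where
  "homogeneous n = {f. \<forall>b. coeff f b \<noteq> 0 \<longrightarrow> wdeg b = n}"

text \<open>The derivation d/dx.  It is determined by the Leibniz rule on words and extended linearly
  and degree by degree to series; it lowers the degree by one, so each coefficient of the
  derivative is a finite sum.  The lemmas \<open>ddx_x\<close>, \<open>ddx_add\<close>, \<open>ddx_scale\<close> and \<open>ddx_mult\<close> below
  say that it is a linear derivation with value 1 at the generator.\<close>

primrec ddx_tree :: "magma \<Rightarrow> 'k::field nas" where
  "ddx_tree X = 1"
| "ddx_tree (u \<bullet> v) = ddx_tree u * monom (Some v) + monom (Some u) * ddx_tree v"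

primrec ddx_word :: "word \<Rightarrow> 'k::field nas" where
  "ddx_word None = 0"
| "ddx_word (Some t) = ddx_tree t"

definition ddx :: "'k::field nas \<Rightarrow> 'k nas" where
  "ddx f = Series (\<lambda>b. \<Sum>s | wdeg s = wdeg b + 1. coeff f s * coeff (ddx_word s) b)"

text \<open>Below, \<open>A\<close> is either \<^term>\<open>polys\<close> or \<^term>\<open>UNIV\<close> (all series).\<close>

definition A0 :: "'k::field nas set \<Rightarrow> 'k nas set" where
  "A0 A = {a \<in> A. ddx a = 0}"

text \<open>The infinite sum in a Taylor expansion converges in the product topology: every coefficient
  of the partial sums is eventually constant.\<close>

definition taylor_expansion :: "'k::field nas set \<Rightarrow> 'k nas \<Rightarrow> (nat \<Rightarrow> 'k nas) \<Rightarrow> bool" where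
  "taylor_expansion A f a \<longleftrightarrow>
     (\<forall>j. a j \<in> A0 A) \<and>
     (\<forall>b. \<forall>\<^sub>F N in sequentially.
        coeff (\<Sum>j<N. ((\<lambda>g. monom (Some X) * g) ^^ j) (a j)) b = coeff f b)"

definition taylor_coeff :: "'k::field nas set \<Rightarrow> 'k nas \<Rightarrow> nat \<Rightarrow> 'k nas" where
  "taylor_coeff A f = (THE a. taylor_expansion A f a)"

definition Phi :: "'k::field nas set \<Rightarrow> 'k nas \<Rightarrow> 'k nas" where
  "Phi A f = taylor_coeff A f 0"

text \<open>\<^term>\<open>Gamma\<close> does not contain the unit word \<^term>\<open>None\<close>.  As the constants are killed by the
  derivation, a basis of \<^term>\<open>A0 A\<close> is indexed by \<^term>\<open>Gamma\<close> together with the unit word.\<close>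

definition Gamma :: "magma set" where
  "Gamma = UNIV - ({X \<bullet> t | t. True} \<union> {X})"

text \<open>Bases of a space of series in the topological sense: arbitrary families of scalars give
  summable families, and each element of the space is such an infinite sum in a unique way.\<close>

definition series_sum :: "'i set \<Rightarrow> ('i \<Rightarrow> 'k::field nas) \<Rightarrow> 'k nas \<Rightarrow> bool" where
  "series_sum S F f \<longleftrightarrow>
     (\<forall>b. finite {s \<in> S. coeff (F s) b \<noteq> 0} \<and>
          coeff f b = (\<Sum>s | s \<in> S \<and> coeff (F s) b \<noteq> 0. coeff (F s) b))"

definition series_basis :: "'i set \<Rightarrow> ('i \<Rightarrow> 'k::field nas) \<Rightarrow> 'k nas set \<Rightarrow> bool" where
  "series_basis S e V \<longleftrightarrow>
     (\<forall>c. \<exists>f\<in>V. series_sum S (\<lambda>s. scale (c s) (e s)) f) \<and>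
     (\<forall>f\<in>V. \<exists>!c. (\<forall>s. s \<notin> S \<longrightarrow> c s = 0) \<and> series_sum S (\<lambda>s. scale (c s) (e s)) f)"

text \<open>The formula makes sense for positive \<^term>\<open>n\<close> only; \<open>c\<^sub>0 = 1\<close> is the dimension of the
  component of degree 0 of the free unital algebra.\<close>

definition catalan :: "nat \<Rightarrow> rat" where
  "catalan n = (if n = 0 then 1 else fact (2 * (n - 1)) / (fact n * fact (n - 1)))"

subsection \<open>The derivation property\<close>

lemma wmul_None_right [simp]: "wmul p None = p"
  by (cases p) auto

lemma deg_pos: "deg t > 0"
  by (induction t) auto

lemma wdeg_wmul [simp]: "wdeg (wmul p q) = wdeg p + wdeg q"
  by (cases p; cases q) auto

lemma factorisations:
  "{(p, q). wmul p q = None} = {(None, None)}"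
  "{(p, q). wmul p q = Some X} = {(None, Some X), (Some X, None)}"
  "{(p, q). wmul p q = Some (u \<bullet> v)} =
     {(None, Some (u \<bullet> v)), (Some (u \<bullet> v), None), (Some u, Some v)}"
  by (auto elim!: wmul.elims)

lemma finite_factorisations: "finite {(p, q). wmul p q = b}"
proof (cases b)
  case (Some t)
  then show ?thesis by (cases t) (simp_all add: factorisations)
qed (simp add: factorisations)

lemma finite_deg_le: "finite {t. deg t \<le> n}"
proof (induction n)
  case 0
  have "{t. deg t \<le> 0} = {}" using deg_pos leD by blast
  then show ?case by (simp only: finite.emptyI)
next
  case (Suc n)
  have "{t. deg t \<le> Suc n} \<subseteq> insert X ((\<lambda>(u, v). u \<bullet> v) ` ({t. deg t \<le> n} \<times> {t. deg t \<le> n}))"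
  proof
    fix t assume t: "t \<in> {t. deg t \<le> Suc n}"
    show "t \<in> insert X ((\<lambda>(u, v). u \<bullet> v) ` ({t. deg t \<le> n} \<times> {t. deg t \<le> n}))"
    proof (cases t)
      case (Mul u v)
      then have "deg u \<le> n" "deg v \<le> n"
        using t deg_pos[of u] deg_pos[of v] by auto
      then show ?thesis using Mul by auto
    qed simp
  qed
  then show ?case using Suc by (meson finite_SigmaI finite_imageI finite_insert finite_subset)
qed

lemma finite_wdeg: "finite {s. wdeg s = n}"
proof (rule finite_subset)
  show "{s. wdeg s = n} \<subseteq> insert None (Some ` {t. deg t \<le> n})"
  proof
    fix s assume "s \<in> {s. wdeg s = n}"
    then show "s \<in> insert None (Some ` {t. deg t \<le> n})" by (cases s) auto
  qed
qed (simp add: finite_deg_le)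

lemma coeff_times: "coeff (f * g) b = (\<Sum>(p, q) | wmul p q = b. coeff f p * coeff g q)"
  by (simp add: times_nas_def)

lemma coeff_ddx: "coeff (ddx f) b = (\<Sum>s | wdeg s = wdeg b + 1. coeff f s * coeff (ddx_word s) b)"
  by (simp add: ddx_def)

lemma one_mult [simp]: "1 * f = (f :: 'k::field nas)"
  and mult_one [simp]: "f * 1 = f"
proof -
  have *: "coeff (1 * f) b = coeff f b \<and> coeff (f * 1) b = coeff f b" for b
  proof (cases b)
    case (Some t)
    then show ?thesis
      by (cases t) (simp_all add: coeff_times factorisations one_nas_def coeff_monom)
  qed (simp add: coeff_times factorisations one_nas_def coeff_monom)
  then show "1 * f = f" "f * 1 = f" by (auto intro: nas_eqI)
qed

lemma monom_mult: "monom p * monom q = (monom (wmul p q) :: 'k::field nas)"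
proof (rule nas_eqI)
  fix b
  have "coeff (monom p * monom q :: 'k nas) b
      = (\<Sum>z | (\<lambda>(p, q). wmul p q = b) z. if z = (p, q) then 1 else 0)"
    unfolding coeff_times by (rule sum.cong) (auto simp: coeff_monom split: if_splits)
  then show "coeff (monom p * monom q :: 'k nas) b = coeff (monom (wmul p q)) b"
    using finite_factorisations[of b] by (auto simp: coeff_monom)
qed

lemma ddx_word_wmul: "ddx_word (wmul p q) = ddx_word p * monom q + monom p * ddx_word q"
proof -
  have "0 * f = 0" "f * 0 = 0" for f :: "'a nas"
    by (auto intro!: nas_eqI simp: coeff_times)
  then show ?thesis
    by (cases p; cases q) (simp_all flip: one_nas_def)
qed

lemma ddx_add: "ddx (f + g) = ddx f + ddx g"
  by (rule nas_eqI) (simp add: coeff_ddx algebra_simps sum.distrib)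

lemma ddx_scale: "ddx (scale c f) = scale c (ddx f)"
  by (rule nas_eqI) (simp add: coeff_ddx algebra_simps sum_distrib_left)

lemma coeff_ddx_word: "coeff (ddx_word s) b \<noteq> (0 :: 'k::field) \<Longrightarrow> wdeg s = wdeg b + 1"
proof -
  have tree: "coeff (ddx_tree t) b \<noteq> (0 :: 'k) \<Longrightarrow> deg t = wdeg b + 1" for t b
  proof (induction t arbitrary: b)
    case X
    then show ?case by (auto simp: one_nas_def coeff_monom split: if_splits)
  next
    case (Mul u v)
    then consider "coeff (ddx_tree u * monom (Some v)) b \<noteq> (0 :: 'k)"
      | "coeff (monom (Some u) * ddx_tree v) b \<noteq> (0 :: 'k)" by fastforce
    then show ?case
    proof cases
      case 1
      then obtain z where "z \<in> {(p, q). wmul p q = b}"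
        "(case z of (p, q) \<Rightarrow> coeff (ddx_tree u) p * coeff (monom (Some v)) q) \<noteq> (0 :: 'k)"
        unfolding coeff_times by (rule sum.not_neutral_contains_not_neutral)
      then show ?thesis using Mul.IH(1) by (auto simp: coeff_monom split: if_splits)
    next
      case 2
      then obtain z where "z \<in> {(p, q). wmul p q = b}"
        "(case z of (p, q) \<Rightarrow> coeff (monom (Some u)) p * coeff (ddx_tree v) q) \<noteq> (0 :: 'k)"
        unfolding coeff_times by (rule sum.not_neutral_contains_not_neutral)
      then show ?thesis using Mul.IH(2) by (auto simp: coeff_monom split: if_splits)
    qed
  qed
  then show "coeff (ddx_word s) b \<noteq> (0 :: 'k) \<Longrightarrow> wdeg s = wdeg b + 1"
    by (cases s) auto
qed

lemma ddx_monom: "ddx (monom s) = ddx_word s"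
proof (rule nas_eqI)
  fix b
  have "coeff (ddx (monom s)) b = (\<Sum>t | wdeg t = wdeg b + 1. if t = s then coeff (ddx_word s) b else 0)"
    unfolding coeff_ddx by (rule sum.cong) (auto simp: coeff_monom)
  also have "\<dots> = coeff (ddx_word s) b"
    using coeff_ddx_word[of s b] by (auto simp: finite_wdeg)
  finally show "coeff (ddx (monom s)) b = coeff (ddx_word s) b" .
qed

lemma ddx_x: "ddx (monom (Some X)) = 1"
  by (simp add: ddx_monom)

lemma ddx_mult: "ddx (f * g) = ddx f * g + f * ddx g" for f g :: "'k::field nas"
proof (rule nas_eqI)
  fix b
  let ?n = "wdeg b + 1"
  let ?F = "{(p, q). wmul p q = b}"
  let ?P = "{(p, q). wdeg p + wdeg q = ?n}"
  let ?d = "\<lambda>s. coeff (ddx_word s) :: word \<Rightarrow> 'k"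
  have "?P \<subseteq> (\<Union>i\<le>?n. {s. wdeg s = i}) \<times> (\<Union>i\<le>?n. {s. wdeg s = i})" by auto
  then have finP: "finite ?P"
    by (rule finite_subset) (intro finite_SigmaI finite_UN_I finite_wdeg finite_atMost)
  have finF: "finite ?F" by (rule finite_factorisations)

  have "coeff (ddx (f * g)) b =
      (\<Sum>s | wdeg s = ?n. \<Sum>z | z \<in> ?P \<and> case_prod wmul z = s.
         case z of (p, q) \<Rightarrow> coeff f p * coeff g q * ?d (wmul p q) b)"
    unfolding coeff_ddx coeff_times sum_distrib_right
    by (intro sum.cong) auto
  also have "\<dots> = (\<Sum>(p, q)\<in>?P. coeff f p * coeff g q * ?d (wmul p q) b)"
    by (rule sum.group[OF finP finite_wdeg]) auto
  also have "\<dots> = (\<Sum>(p, q)\<in>?P. coeff f p * coeff g q * coeff (ddx_word p * monom q) b)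
      + (\<Sum>(p, q)\<in>?P. coeff f p * coeff g q * coeff (monom p * ddx_word q) b)"
    by (simp add: ddx_word_wmul algebra_simps case_prod_unfold sum.distrib)
  also have "(\<Sum>(p, q)\<in>?P. coeff f p * coeff g q * coeff (ddx_word p * monom q) b)
      = coeff (ddx f * g) b"
  proof -
    have "(\<Sum>(p, q)\<in>?P. coeff f p * coeff g q * coeff (ddx_word p * monom q) b)
      = (\<Sum>z\<in>?P. \<Sum>w\<in>?F. coeff f (fst z) * coeff g (snd z) *
            (?d (fst z) (fst w) * coeff (monom (snd z)) (snd w)))"
      by (simp add: coeff_times case_prod_unfold sum_distrib_left)
    also have "\<dots> = (\<Sum>w\<in>?F. \<Sum>z\<in>?P. coeff f (fst z) * coeff g (snd z) *
            (?d (fst z) (fst w) * coeff (monom (snd z)) (snd w)))"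
      by (rule sum.swap)
    also have "\<dots> = (\<Sum>w\<in>?F. \<Sum>p | wdeg p = wdeg (fst w) + 1.
            coeff f p * ?d p (fst w) * coeff g (snd w))"
    proof (rule sum.cong[OF refl])
      fix w assume w: "w \<in> ?F"
      have "(\<Sum>z\<in>?P. coeff f (fst z) * coeff g (snd z) *
            (?d (fst z) (fst w) * coeff (monom (snd z)) (snd w)))
        = (\<Sum>z\<in>(\<lambda>p. (p, snd w)) ` {p. wdeg p = wdeg (fst w) + 1}. coeff f (fst z) * coeff g (snd z) *
            (?d (fst z) (fst w) * coeff (monom (snd z)) (snd w)))"
        by (rule sum.mono_neutral_right[OF finP]) (use w in \<open>auto simp: coeff_monom\<close>)
      also have "\<dots> = (\<Sum>p | wdeg p = wdeg (fst w) + 1. coeff f p * ?d p (fst w) * coeff g (snd w))"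
        by (subst sum.reindex) (auto simp: inj_on_def coeff_monom algebra_simps)
      finally show "(\<Sum>z\<in>?P. coeff f (fst z) * coeff g (snd z) *
            (?d (fst z) (fst w) * coeff (monom (snd z)) (snd w)))
        = (\<Sum>p | wdeg p = wdeg (fst w) + 1. coeff f p * ?d p (fst w) * coeff g (snd w))" .
    qed
    also have "\<dots> = coeff (ddx f * g) b"
      by (simp add: coeff_times coeff_ddx case_prod_unfold sum_distrib_right)
    finally show ?thesis .
  qed
  also have "(\<Sum>(p, q)\<in>?P. coeff f p * coeff g q * coeff (monom p * ddx_word q) b)
      = coeff (f * ddx g) b"
  proof -
    have "(\<Sum>(p, q)\<in>?P. coeff f p * coeff g q * coeff (monom p * ddx_word q) b)
      = (\<Sum>z\<in>?P. \<Sum>w\<in>?F. coeff f (fst z) * coeff g (snd z) *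
            (coeff (monom (fst z)) (fst w) * ?d (snd z) (snd w)))"
      by (simp add: coeff_times case_prod_unfold sum_distrib_left)
    also have "\<dots> = (\<Sum>w\<in>?F. \<Sum>z\<in>?P. coeff f (fst z) * coeff g (snd z) *
            (coeff (monom (fst z)) (fst w) * ?d (snd z) (snd w)))"
      by (rule sum.swap)
    also have "\<dots> = (\<Sum>w\<in>?F. \<Sum>q | wdeg q = wdeg (snd w) + 1.
            coeff f (fst w) * (coeff g q * ?d q (snd w)))"
    proof (rule sum.cong[OF refl])
      fix w assume w: "w \<in> ?F"
      have "(\<Sum>z\<in>?P. coeff f (fst z) * coeff g (snd z) *
            (coeff (monom (fst z)) (fst w) * ?d (snd z) (snd w)))
        = (\<Sum>z\<in>(\<lambda>q. (fst w, q)) ` {q. wdeg q = wdeg (snd w) + 1}. coeff f (fst z) * coeff g (snd z) *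
            (coeff (monom (fst z)) (fst w) * ?d (snd z) (snd w)))"
        by (rule sum.mono_neutral_right[OF finP]) (use w in \<open>auto simp: coeff_monom\<close>)
      also have "\<dots> = (\<Sum>q | wdeg q = wdeg (snd w) + 1. coeff f (fst w) * (coeff g q * ?d q (snd w)))"
        by (subst sum.reindex) (auto simp: inj_on_def coeff_monom algebra_simps)
      finally show "(\<Sum>z\<in>?P. coeff f (fst z) * coeff g (snd z) *
            (coeff (monom (fst z)) (fst w) * ?d (snd z) (snd w)))
        = (\<Sum>q | wdeg q = wdeg (snd w) + 1. coeff f (fst w) * (coeff g q * ?d q (snd w)))" .
    qed
    also have "\<dots> = coeff (f * ddx g) b"
      by (simp add: coeff_times coeff_ddx case_prod_unfold sum_distrib_left)
    finally show ?thesis .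
  qed
  finally show "coeff (ddx (f * g)) b = coeff (ddx f * g + f * ddx g) b" by simp
qed

end

theory Submission
  imports Defs
begin

text \<open>Let \<open>L\<close> be left multiplication by \<open>x\<close> and \<open>D = d/dx\<close>.  The Leibniz rule gives
  \<open>D L - L D = 1\<close>, so the two operators satisfy the relation of the Weyl algebra.  By this relation the
  series
  \<open>P = \<Sum>\<^sub>k (-1)\<^sup>k / k! L\<^sup>k D\<^sup>k\<close> satisfies \<open>D P = 0\<close> and \<open>P L = 0\<close> by telescoping, and it is the
  identity on \<open>ker D\<close> because only the term \<open>k = 0\<close> survives there.  Hence \<open>P\<close> projects onto the
  constants along the image of \<open>L\<close>.  As \<open>f - P f\<close> lies in the image of \<open>L\<close>, one may divide it
  by \<open>x\<close> and repeat; this produces the Taylor expansion of \<open>f\<close>, with zeroth coefficient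
  \<open>P f\<close>.  Applying \<open>P\<close> to an arbitrary expansion shows that there is no other one, so that
  \<open>\<Phi> = P\<close>.

  Left multiplication by \<open>x\<close> is injective on words.  Call a word reduced if it is not in
  \<open>x \<cdot> words\<close>: the reduced words are the unit and the elements of \<open>\<Gamma>\<close>.  Elements of the image of \<open>L\<close>
  have no reduced words in their support, so \<open>f\<close> and \<open>\<Phi>(f)\<close> have the same coefficients at
  reduced words (\<open>coeff_const_proj_reduced\<close>).  Two things follow.  A constant is determined by
  its coefficients at reduced words (\<open>const_eqI\<close>): if they all vanish, then \<open>f = L g\<close> and
  \<open>f = \<Phi>(f) = \<Phi>(L g) = 0\<close>.  And for reduced words \<open>s\<close>, \<open>t\<close> the coefficient of \<open>\<Phi>(s)\<close> at \<open>t\<close> is the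
  Kronecker delta.  So \<open>\<Phi>\<close> of the reduced words is a basis whose coordinate functions are
  the coefficients at reduced words; this one argument serves polynomials, series and homogeneous
  components alike.

  The dimension in degree \<open>n\<close> is then the number of all words of degree \<open>n\<close> minus the number of
  those of the form \<open>x \<cdot> w\<close>, which are as many as the words of degree \<open>n - 1\<close>.  Words are counted
  by splitting a tree at its root, which gives the Catalan recurrence; the closed formula
  satisfies it by a telescoping sum (\<open>catalan_convolution\<close>).\<close>

section \<open>Left multiplication by the generator\<close>

definition lmul_x :: "'k::field nas \<Rightarrow> 'k nas" where
  "lmul_x g = monom (Some X) * g"

text \<open>These words form a complement to the image of left multiplication by \<open>x\<close>; that they are the index
  set of the theorem is \<open>reduced_eq\<close>.  Using \<^term>\<open>wmul (Some X)\<close> treats \<open>x = x \<cdot> 1\<close> on the same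
  footing as the products \<open>x \<cdot> t\<close>.\<close>

definition reduced :: "word set" where
  "reduced = - range (wmul (Some X))"

lemma reduced_eq: "reduced = insert None (Some ` Gamma)"
proof (rule set_eqI)
  fix b
  show "b \<in> reduced \<longleftrightarrow> b \<in> insert None (Some ` Gamma)"
  proof (cases b)
    case None
    have "None \<noteq> wmul (Some X) w" for w by (cases w) auto
    then show ?thesis using None by (auto simp: reduced_def)
  next
    case (Some t)
    have "Some t \<in> range (wmul (Some X)) \<longleftrightarrow> t = X \<or> (\<exists>u. t = X \<bullet> u)"
    proof
      assume "Some t \<in> range (wmul (Some X))"
      then obtain w where "Some t = wmul (Some X) w" by blast
      then show "t = X \<or> (\<exists>u. t = X \<bullet> u)" by (cases w) auto
    next
      assume "t = X \<or> (\<exists>u. t = X \<bullet> u)"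
      then have "Some t = wmul (Some X) None \<or> (\<exists>u. Some t = wmul (Some X) (Some u))" by auto
      then show "Some t \<in> range (wmul (Some X))" by blast
    qed
    then show ?thesis using Some by (auto simp: reduced_def Gamma_def)
  qed
qed

lemma reduced_cases:
  obtains "b \<in> reduced" | w where "b = wmul (Some X) w"
  by (auto simp: reduced_def)

lemma coeff_lmul_x_wmul [simp]: "coeff (lmul_x g) (wmul (Some X) b) = coeff g b"
  by (cases b) (simp_all add: lmul_x_def coeff_times factorisations coeff_monom)

lemma coeff_lmul_x_reduced: "b \<in> reduced \<Longrightarrow> coeff (lmul_x g) b = 0"
proof (cases b)
  case (Some t)
  assume "b \<in> reduced"
  with Some have "t \<noteq> X" "\<nexists>u. t = X \<bullet> u" by (auto simp: reduced_eq Gamma_def)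
  then show ?thesis using Some
    by (cases t) (auto simp: lmul_x_def coeff_times factorisations coeff_monom)
qed (simp add: lmul_x_def coeff_times factorisations coeff_monom)

definition strip_x :: "'k nas \<Rightarrow> 'k nas" where
  "strip_x f = Series (\<lambda>b. coeff f (wmul (Some X) b))"

lemma coeff_strip_x [simp]: "coeff (strip_x f) b = coeff f (wmul (Some X) b)"
  by (simp add: strip_x_def)

text \<open>The image of \<^term>\<open>lmul_x\<close> is cut out by the vanishing of the coefficients at reduced words.\<close>

lemma lmul_x_strip_x:
  assumes "\<And>b. b \<in> reduced \<Longrightarrow> coeff f b = 0"
  shows "lmul_x (strip_x f) = f"
proof (rule nas_eqI)
  fix b
  show "coeff (lmul_x (strip_x f)) b = coeff f b"
    by (rule reduced_cases[of b]) (simp_all add: coeff_lmul_x_reduced assms)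
qed

interpretation lmul_x: Vector_Spaces.linear scale scale "lmul_x :: 'k::field nas \<Rightarrow> 'k nas"
proof
  have *: "coeff (lmul_x (f + g)) b = coeff (lmul_x f) b + coeff (lmul_x g) b"
    and **: "coeff (lmul_x (scale c f)) b = c * coeff (lmul_x f) b" for f g :: "'k nas" and b c
    by (rule reduced_cases[of b]; simp add: coeff_lmul_x_reduced)+
  show "lmul_x (f + g) = lmul_x f + lmul_x g" "lmul_x (scale c f) = scale c (lmul_x f)"
    for f g :: "'k nas" and c
    by (auto intro!: nas_eqI simp: * **)
qed

interpretation ddx: Vector_Spaces.linear scale scale "ddx :: 'k::field nas \<Rightarrow> 'k nas"
  by standard (simp_all add: ddx_add ddx_scale)

lemma linear_funpow:
  assumes "Vector_Spaces.linear scale scale (F :: 'k::field nas \<Rightarrow> 'k nas)"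
  shows "Vector_Spaces.linear scale scale (F ^^ k)"
proof -
  interpret F: Vector_Spaces.linear scale scale F by fact
  have "(F ^^ k) (f + g) = (F ^^ k) f + (F ^^ k) g" "(F ^^ k) (scale c f) = scale c ((F ^^ k) f)"
    for f g c by (induction k) (simp_all add: F.add F.scale)
  then show ?thesis by unfold_locales
qed

interpretation lmul_x_pow: Vector_Spaces.linear scale scale "lmul_x ^^ k :: 'k::field nas \<Rightarrow> 'k nas" for k
  by (rule linear_funpow) unfold_locales

interpretation ddx_pow: Vector_Spaces.linear scale scale "ddx ^^ k :: 'k::field nas \<Rightarrow> 'k nas" for k
  by (rule linear_funpow) unfold_locales

section \<open>The Weyl relation\<close>

lemma ddx_lmul_x: "ddx (lmul_x g) = g + lmul_x (ddx g)"
  by (simp add: lmul_x_def ddx_mult ddx_x)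

text \<open>The two commutation rules \<open>D L\<^sup>k = L\<^sup>k D + k L\<^sup>k\<^sup>-\<^sup>1\<close> and \<open>D\<^sup>k L = L D\<^sup>k + k D\<^sup>k\<^sup>-\<^sup>1\<close> are what makes
  the projection defined below telescope, from the left and from the right respectively.\<close>

lemma ddx_lmul_x_pow:
  "ddx ((lmul_x ^^ Suc k) g) = scale (of_nat (Suc k)) ((lmul_x ^^ k) g) + (lmul_x ^^ Suc k) (ddx g)"
proof (induction k)
  case (Suc k)
  have "ddx ((lmul_x ^^ Suc (Suc k)) g)
      = (lmul_x ^^ Suc k) g + lmul_x (ddx ((lmul_x ^^ Suc k) g))"
    by (simp only: funpow.simps o_apply ddx_lmul_x)
  also have "\<dots> = scale (of_nat (Suc (Suc k))) ((lmul_x ^^ Suc k) g) + (lmul_x ^^ Suc (Suc k)) (ddx g)"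
    unfolding Suc.IH lmul_x.add lmul_x.scale
    by (simp add: of_nat_Suc[of "Suc k"] nas.scale_left_distrib del: of_nat_Suc)
  finally show ?case .
qed (simp add: ddx_lmul_x)

lemma ddx_pow_lmul_x:
  "(ddx ^^ Suc k) (lmul_x g) = lmul_x ((ddx ^^ Suc k) g) + scale (of_nat (Suc k)) ((ddx ^^ k) g)"
proof (induction k)
  case (Suc k)
  have "(ddx ^^ Suc (Suc k)) (lmul_x g) = ddx ((ddx ^^ Suc k) (lmul_x g))" by simp
  also have "\<dots> = lmul_x ((ddx ^^ Suc (Suc k)) g) + scale (of_nat (Suc (Suc k))) ((ddx ^^ Suc k) g)"
    unfolding Suc.IH ddx.add ddx.scale
    by (simp add: ddx_lmul_x of_nat_Suc[of "Suc k"] nas.scale_left_distrib del: of_nat_Suc)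
  finally show ?case .
qed (simp add: ddx_lmul_x)

section \<open>Locality of the operators in the degree\<close>

text \<open>One notion controls everything that concerns degrees: homogeneity, finiteness of the support and
  continuity for the product topology are all statements about the degrees in which a series
  vanishes.\<close>

definition vanishes_at :: "nat \<Rightarrow> 'k::zero nas \<Rightarrow> bool" where
  "vanishes_at n f \<longleftrightarrow> (\<forall>b. wdeg b = n \<longrightarrow> coeff f b = 0)"

lemma homogeneous_iff: "f \<in> homogeneous n \<longleftrightarrow> (\<forall>m. m \<noteq> n \<longrightarrow> vanishes_at m f)"
  by (auto simp: homogeneous_def vanishes_at_def)

lemma polys_iff: "f \<in> polys \<longleftrightarrow> (\<exists>N. \<forall>n\<ge>N. vanishes_at n f)"
proof
  assume "f \<in> polys"
  then have fin: "finite (wdeg ` {b. coeff f b \<noteq> 0})" by (simp add: polys_def)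
  then obtain N where "\<forall>n \<in> wdeg ` {b. coeff f b \<noteq> 0}. n < N"
    using finite_nat_set_iff_bounded by blast
  then have "\<forall>n\<ge>N. vanishes_at n f" by (force simp: vanishes_at_def)
  then show "\<exists>N. \<forall>n\<ge>N. vanishes_at n f" ..
next
  assume "\<exists>N. \<forall>n\<ge>N. vanishes_at n f"
  then obtain N where "\<forall>n\<ge>N. vanishes_at n f" ..
  then have "{b. coeff f b \<noteq> 0} \<subseteq> (\<Union>n<N. {b. wdeg b = n})"
    by (force simp: vanishes_at_def not_le[symmetric])
  then have "finite {b. coeff f b \<noteq> 0}" by (rule finite_subset) (simp add: finite_wdeg)
  then show "f \<in> polys" by (simp add: polys_def)
qed

lemma homogeneous_imp_polys: "f \<in> homogeneous n \<Longrightarrow> f \<in> polys"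
  unfolding homogeneous_iff polys_iff by (intro exI[of _ "Suc n"]) auto

lemma monom_homogeneous: "monom b \<in> homogeneous (wdeg b)"
  by (auto simp: homogeneous_def coeff_monom split: if_splits)

lemma vanishes_at_ddx_pow: "vanishes_at (n + k) f \<Longrightarrow> vanishes_at n ((ddx ^^ k) f)"
proof (induction k arbitrary: n)
  case (Suc k)
  then have "vanishes_at (Suc n) ((ddx ^^ k) f)" by simp
  then show ?case by (auto simp: vanishes_at_def coeff_ddx)
qed simp

text \<open>The premise is conditional because \<open>L\<^sup>k g\<close> has no terms of degree less than \<open>k\<close> at all, whatever
  \<open>g\<close> is.\<close>

lemma vanishes_at_lmul_x_pow:
  assumes "n \<ge> k \<Longrightarrow> vanishes_at (n - k) f"
  shows "vanishes_at n ((lmul_x ^^ k) f)"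
  using assms
proof (induction k arbitrary: n)
  case (Suc k)
  show ?case unfolding vanishes_at_def
  proof (intro allI impI)
    fix b :: word assume b: "wdeg b = n"
    show "coeff ((lmul_x ^^ Suc k) f) b = 0"
    proof (rule reduced_cases[of b])
      fix w assume w: "b = wmul (Some X) w"
      then have n: "n = Suc (wdeg w)" using b by simp
      have "vanishes_at (wdeg w) ((lmul_x ^^ k) f)"
        by (rule Suc.IH) (use Suc.prems n in simp)
      then show ?thesis using w by (simp add: vanishes_at_def)
    qed (simp add: coeff_lmul_x_reduced)
  qed
qed simp

lemma coeff_lmul_x_pow_low: "wdeg b < k \<Longrightarrow> coeff ((lmul_x ^^ k) f) b = 0"
  using vanishes_at_lmul_x_pow[of k "wdeg b" f] by (simp add: vanishes_at_def)

section \<open>The projection onto the constants\<close>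

definition const_proj_upto :: "nat \<Rightarrow> 'k::field_char_0 nas \<Rightarrow> 'k nas" where
  "const_proj_upto N f = (\<Sum>k<N. scale ((-1) ^ k / fact k) ((lmul_x ^^ k) ((ddx ^^ k) f)))"

text \<open>The terms with \<open>k > wdeg b\<close> contribute nothing to the coefficient at \<open>b\<close>, so cutting the sum off
  there gives the value of the infinite sum.\<close>

definition const_proj :: "'k::field_char_0 nas \<Rightarrow> 'k nas" where
  "const_proj f = Series (\<lambda>b. coeff (const_proj_upto (Suc (wdeg b)) f) b)"

lemma coeff_const_proj:
  assumes "wdeg b < N"
  shows "coeff (const_proj f) b = coeff (const_proj_upto N f) b"
proof -
  have "coeff (const_proj_upto N f) b = coeff (const_proj_upto (Suc (wdeg b)) f) b"
    unfolding const_proj_upto_def coeff_sum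
    by (rule sum.mono_neutral_right) (use assms in \<open>auto simp: coeff_lmul_x_pow_low\<close>)
  then show ?thesis by (simp add: const_proj_def)
qed

interpretation const_proj: Vector_Spaces.linear scale scale "const_proj :: 'k::field_char_0 nas \<Rightarrow> 'k nas"
proof
  show "const_proj (f + g) = const_proj f + const_proj g"
    "const_proj (scale c f) = scale c (const_proj f)" for f g :: "'k nas" and c
    by (auto intro!: nas_eqI simp: const_proj_def const_proj_upto_def ddx_pow.add ddx_pow.scale
        lmul_x_pow.add lmul_x_pow.scale sum.distrib sum_distrib_left algebra_simps
        simp del: funpow.simps)
qed

lemma vanishes_at_const_proj:
  assumes "vanishes_at n f"
  shows "vanishes_at n (const_proj f)"
proof -
  have "vanishes_at n ((lmul_x ^^ k) ((ddx ^^ k) f))" for k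
    by (intro vanishes_at_lmul_x_pow vanishes_at_ddx_pow) (use assms in simp)
  then show ?thesis
    by (auto simp: vanishes_at_def const_proj_def const_proj_upto_def)
qed

lemma const_proj_const:
  assumes "ddx f = 0"
  shows "const_proj f = f"
proof (rule nas_eqI)
  fix b
  have "(ddx ^^ Suc k) f = 0" for k
    by (simp only: funpow_Suc_right o_apply assms ddx_pow.zero)
  then have "const_proj_upto (Suc N) f = f" for N
    by (induction N) (simp_all add: const_proj_upto_def lmul_x_pow.zero lmul_x.zero)
  then show "coeff (const_proj f) b = coeff f b"
    by (simp add: const_proj_def)
qed

text \<open>Applying \<open>D\<close> to the partial sum with \<open>k \<le> N\<close> leaves only the last term
  \<open>(-1)\<^sup>N / N! L\<^sup>N D\<^sup>N\<^sup>+\<^sup>1 f\<close>, which has no terms of degree less than \<open>N\<close>.\<close>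

lemma ddx_const_proj: "ddx (const_proj f) = (0 :: 'k::field_char_0 nas)"
proof (rule nas_eqI)
  fix b
  \<comment> \<open>The derivative at \<open>b\<close> involves coefficients of degree \<open>wdeg b + 1\<close>, so the partial sum has
    to reach one degree further than that of \<open>b\<close>.\<close>
  let ?N = "Suc (Suc (wdeg b))"
  have *: "ddx (const_proj_upto (Suc N) f) = scale ((-1) ^ N / fact N) ((lmul_x ^^ N) ((ddx ^^ Suc N) f))"
    for N
  proof (induction N)
    case (Suc N)
    have "const_proj_upto (Suc (Suc N)) f = const_proj_upto (Suc N) f
        + scale ((-1) ^ Suc N / fact (Suc N)) ((lmul_x ^^ Suc N) ((ddx ^^ Suc N) f))"
      by (simp add: const_proj_upto_def)
    moreover have "(-1) ^ Suc N / fact (Suc N) * of_nat (Suc N) = - ((-1) ^ N / fact N :: 'k)"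
      by (simp add: field_simps del: of_nat_Suc)
    ultimately show ?case
      by (simp only: ddx.add ddx.scale Suc.IH ddx_lmul_x_pow nas.scale_right_distrib
          nas.scale_scale nas.scale_minus_left) simp
  qed (simp add: const_proj_upto_def)
  have "coeff (ddx (const_proj f)) b = coeff (ddx (const_proj_upto ?N f)) b"
    unfolding coeff_ddx by (intro sum.cong refl) (simp add: coeff_const_proj)
  also have "\<dots> = 0"
    by (simp only: * coeff_scale coeff_lmul_x_pow_low lessI mult_zero_right)
  finally show "coeff (ddx (const_proj f)) b = coeff 0 b" by simp
qed

text \<open>Here the partial sum with \<open>k \<le> N\<close> collapses to \<open>(-1)\<^sup>N / N! L\<^sup>N\<^sup>+\<^sup>1 D\<^sup>N g\<close>.\<close>

lemma const_proj_lmul_x: "const_proj (lmul_x g) = (0 :: 'k::field_char_0 nas)"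
proof (rule nas_eqI)
  fix b
  have *: "const_proj_upto (Suc N) (lmul_x g)
      = scale ((-1) ^ N / fact N) ((lmul_x ^^ Suc N) ((ddx ^^ N) g))" for N
  proof (induction N)
    case (Suc N)
    have "const_proj_upto (Suc (Suc N)) (lmul_x g) = const_proj_upto (Suc N) (lmul_x g)
        + scale ((-1) ^ Suc N / fact (Suc N)) ((lmul_x ^^ Suc N) ((ddx ^^ Suc N) (lmul_x g)))"
      by (simp add: const_proj_upto_def)
    moreover have "(-1) ^ Suc N / fact (Suc N) * of_nat (Suc N) = - ((-1) ^ N / fact N :: 'k)"
      by (simp add: field_simps del: of_nat_Suc)
    moreover have "(lmul_x ^^ Suc N) (lmul_x h) = (lmul_x ^^ Suc (Suc N)) h" for h :: "'k nas"
      by (simp only: funpow_Suc_right[of "Suc N"] o_apply)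
    ultimately show ?case
      by (simp only: Suc.IH ddx_pow_lmul_x lmul_x_pow.add lmul_x_pow.scale nas.scale_right_distrib
          nas.scale_scale nas.scale_minus_left) simp
  qed (simp add: const_proj_upto_def)
  show "coeff (const_proj (lmul_x g)) b = coeff 0 b"
    by (simp only: const_proj_def coeff_Series * coeff_scale coeff_lmul_x_pow_low less_SucI lessI
        mult_zero_right coeff_zero)
qed

text \<open>All terms of the projection with \<open>k > 0\<close> are left multiples of \<open>x\<close>.\<close>

lemma coeff_const_proj_reduced:
  assumes "b \<in> reduced"
  shows "coeff (const_proj f) b = coeff f b"
  using assms
  by (simp add: const_proj_def const_proj_upto_def sum.lessThan_Suc_shift coeff_lmul_x_reduced
      del: sum.lessThan_Suc)

text \<open>If two constants agree at the reduced words, their difference is a left multiple of \<open>x\<close>, hence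
  killed by the projection, which on the other hand fixes it.\<close>

lemma const_eqI:
  fixes f g :: "'k::field_char_0 nas"
  assumes "ddx f = 0" "ddx g = 0" "\<And>b. b \<in> reduced \<Longrightarrow> coeff f b = coeff g b"
  shows "f = g"
proof -
  have "const_proj (f - g) = const_proj (lmul_x (strip_x (f - g)))"
    using assms(3) by (simp add: lmul_x_strip_x)
  then have "const_proj f - const_proj g = 0"
    by (simp only: const_proj_lmul_x const_proj.diff)
  then show ?thesis using assms by (simp add: const_proj_const)
qed

text \<open>The projection is linear for infinite sums as well: by locality only the finitely many words of
  one degree matter for a given coefficient.\<close>

lemma coeff_const_proj_monom_expansion:
  "coeff (const_proj f) b = (\<Sum>s | wdeg s = wdeg b. coeff f s * coeff (const_proj (monom s)) b)"
proof -
  let ?S = "{s. wdeg s = wdeg b}"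
  let ?g = "\<Sum>s\<in>?S. scale (coeff f s) (monom s)"
  have "coeff ?g w = coeff f w" if "wdeg w = wdeg b" for w
    using that by (simp add: coeff_monom finite_wdeg if_distrib[of "(*) _"] cong: if_cong)
  then have "vanishes_at (wdeg b) (f - ?g)" by (simp add: vanishes_at_def)
  then have "vanishes_at (wdeg b) (const_proj (f - ?g))" by (rule vanishes_at_const_proj)
  then have "coeff (const_proj f) b = coeff (const_proj ?g) b"
    by (simp add: vanishes_at_def const_proj.diff)
  then show ?thesis by (simp add: const_proj.sum const_proj.scale)
qed

section \<open>Taylor expansions\<close>

text \<open>Repeated division with remainder by \<open>x\<close>: the remainder is the projection to the constants and
  \<open>taylor_rest\<close> is the quotient.  The successive remainders are the Taylor coefficients.\<close>

definition taylor_rest :: "'k::field_char_0 nas \<Rightarrow> 'k nas" where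
  "taylor_rest f = strip_x (f - const_proj f)"

lemma const_proj_plus_rest: "f = const_proj f + lmul_x (taylor_rest f)"
  by (simp add: taylor_rest_def lmul_x_strip_x coeff_const_proj_reduced)

lemma taylor_partial_sum:
  "f = (\<Sum>j<N. (lmul_x ^^ j) (const_proj ((taylor_rest ^^ j) f))) + (lmul_x ^^ N) ((taylor_rest ^^ N) f)"
proof (induction N)
  case (Suc N)
  have "(lmul_x ^^ N) ((taylor_rest ^^ N) f)
      = (lmul_x ^^ N) (const_proj ((taylor_rest ^^ N) f) + lmul_x (taylor_rest ((taylor_rest ^^ N) f)))"
    by (simp flip: const_proj_plus_rest)
  also have "\<dots> = (lmul_x ^^ N) (const_proj ((taylor_rest ^^ N) f)) + (lmul_x ^^ Suc N) ((taylor_rest ^^ Suc N) f)"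
    by (simp only: lmul_x_pow.add funpow_Suc_right[of N lmul_x] funpow.simps(2)[of N taylor_rest] o_apply)
  finally show ?case using Suc.IH by (simp only: sum.lessThan_Suc add.assoc)
qed simp

lemma const_proj_polys: "f \<in> polys \<Longrightarrow> const_proj f \<in> polys"
  unfolding polys_iff using vanishes_at_const_proj by blast

lemma taylor_rest_polys:
  assumes "f \<in> polys"
  shows "taylor_rest f \<in> polys"
proof -
  obtain N where N: "\<forall>n\<ge>N. vanishes_at n f" using assms polys_iff by blast
  then have "\<forall>n\<ge>N. vanishes_at n (const_proj f)" by (simp add: vanishes_at_const_proj)
  with N have "coeff f w = 0 \<and> coeff (const_proj f) w = 0" if "wdeg w \<ge> N" for w
    using that by (auto simp: vanishes_at_def)
  then have "\<forall>n\<ge>N. vanishes_at n (taylor_rest f)"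
    by (auto simp: vanishes_at_def taylor_rest_def)
  then show ?thesis by (auto simp: polys_iff)
qed

lemma taylor_expansion_iff:
  "taylor_expansion A f a \<longleftrightarrow> (\<forall>j. a j \<in> A0 A) \<and>
     (\<forall>b. \<forall>\<^sub>F N in sequentially. coeff (\<Sum>j<N. (lmul_x ^^ j) (a j)) b = coeff f b)"
proof -
  have "(\<lambda>g. monom (Some X) * g) = lmul_x" by (rule ext) (simp add: lmul_x_def)
  then show ?thesis unfolding taylor_expansion_def by (rule arg_cong)
qed

lemma taylor_expansion_exists:
  fixes f :: "'k::field_char_0 nas"
  assumes A: "A = polys \<or> A = UNIV" and "f \<in> A"
  shows "taylor_expansion A f (\<lambda>j. const_proj ((taylor_rest ^^ j) f))"
  unfolding taylor_expansion_iff
proof (intro conjI allI)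
  fix j
  have "(taylor_rest ^^ j) f \<in> A" using assms by (induction j) (auto intro: taylor_rest_polys)
  then show "const_proj ((taylor_rest ^^ j) f) \<in> A0 A"
    using A by (auto simp: A0_def ddx_const_proj intro: const_proj_polys)
next
  fix b
  show "\<forall>\<^sub>F N in sequentially.
      coeff (\<Sum>j<N. (lmul_x ^^ j) (const_proj ((taylor_rest ^^ j) f))) b = coeff f b"
    using eventually_gt_at_top[of "wdeg b"]
  proof eventually_elim
    case (elim N)
    show ?case
      by (subst (2) taylor_partial_sum[of f N])
        (simp only: coeff_plus coeff_lmul_x_pow_low[OF elim] add_0_right)
  qed
qed

text \<open>The projection kills all terms \<open>L\<^sup>j a\<^sub>j\<close> with \<open>j > 0\<close> of a partial sum and fixes \<open>a\<^sub>0\<close>.  To pass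
  from partial sums to \<open>f\<close> it is enough, by locality, to choose a partial sum that agrees with
  \<open>f\<close> at all words of one given degree.\<close>

lemma taylor_expansion_zeroth:
  fixes f :: "'k::field_char_0 nas"
  assumes "taylor_expansion A f a"
  shows "a 0 = const_proj f"
proof (rule nas_eqI)
  fix b
  let ?S = "\<lambda>N. \<Sum>j<N. (lmul_x ^^ j) (a j)"
  have "\<forall>\<^sub>F N in sequentially. \<forall>w\<in>{w. wdeg w = wdeg b}. coeff (?S N) w = coeff f w"
    using assms by (intro eventually_ball_finite finite_wdeg) (simp add: taylor_expansion_iff)
  then have "\<forall>\<^sub>F N in sequentially. (\<forall>w\<in>{w. wdeg w = wdeg b}. coeff (?S N) w = coeff f w) \<and> N > 0"
    using eventually_gt_at_top[of 0] by (rule eventually_conj)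
  then obtain N where N: "\<forall>w\<in>{w. wdeg w = wdeg b}. coeff (?S N) w = coeff f w" "N > 0"
    using eventually_happens'[OF sequentially_bot] by blast
  then obtain M where M: "N = Suc M" using gr0_implies_Suc by blast
  have S: "?S N = a 0 + lmul_x (\<Sum>j<M. (lmul_x ^^ j) (a (Suc j)))"
    by (simp add: M sum.lessThan_Suc_shift lmul_x.sum del: sum.lessThan_Suc)
  have "ddx (a 0) = 0" using assms by (simp add: taylor_expansion_iff A0_def)
  then have "const_proj (?S N) = a 0"
    by (simp add: S const_proj.add const_proj_lmul_x const_proj_const)
  moreover have "vanishes_at (wdeg b) (const_proj (f - ?S N))"
    using N(1) by (intro vanishes_at_const_proj) (simp add: vanishes_at_def)
  ultimately show "coeff (a 0) b = coeff (const_proj f) b"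
    by (simp add: vanishes_at_def const_proj.diff)
qed

text \<open>Removing \<open>a\<^sub>0\<close> from an expansion and dividing by \<open>x\<close> leaves an expansion of the quotient; together
  with the previous lemma this determines all the coefficients one after another.\<close>

lemma taylor_expansion_shift:
  fixes f :: "'k::field_char_0 nas"
  assumes "taylor_expansion A f a"
  shows "taylor_expansion A (taylor_rest f) (\<lambda>j. a (Suc j))"
  unfolding taylor_expansion_iff
proof (intro conjI allI)
  show "a (Suc j) \<in> A0 A" for j using assms by (simp add: taylor_expansion_iff)
next
  fix b
  let ?w = "wmul (Some X) b"
  have "\<forall>\<^sub>F N in sequentially. coeff (\<Sum>j<N. (lmul_x ^^ j) (a j)) ?w = coeff f ?w"
    using assms by (simp add: taylor_expansion_iff)
  then have "\<forall>\<^sub>F N in sequentially. coeff (\<Sum>j<Suc N. (lmul_x ^^ j) (a j)) ?w = coeff f ?w"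
    by (subst eventually_sequentially_Suc)
  then show "\<forall>\<^sub>F N in sequentially. coeff (\<Sum>j<N. (lmul_x ^^ j) (a (Suc j))) b = coeff (taylor_rest f) b"
  proof eventually_elim
    case (elim N)
    have "(\<Sum>j<Suc N. (lmul_x ^^ j) (a j)) = const_proj f + lmul_x (\<Sum>j<N. (lmul_x ^^ j) (a (Suc j)))"
      by (simp add: sum.lessThan_Suc_shift lmul_x.sum taylor_expansion_zeroth[OF assms]
          del: sum.lessThan_Suc)
    with elim have "coeff (const_proj f) ?w + coeff (\<Sum>j<N. (lmul_x ^^ j) (a (Suc j))) b = coeff f ?w"
      by (simp only: coeff_plus coeff_lmul_x_wmul)
    then show ?case by (simp add: taylor_rest_def algebra_simps)
  qed
qed

lemma taylor_expansion_unique: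
  fixes f :: "'k::field_char_0 nas"
  assumes "taylor_expansion A f a"
  shows "a j = const_proj ((taylor_rest ^^ j) f)"
  using assms
proof (induction j arbitrary: f a)
  case 0
  then show ?case by (simp add: taylor_expansion_zeroth)
next
  case (Suc j)
  from Suc.IH[OF taylor_expansion_shift[OF Suc.prems]] show ?case
    by (simp add: funpow_swap1)
qed

lemma Phi_eq_const_proj:
  fixes f :: "'k::field_char_0 nas"
  assumes "A = polys \<or> A = UNIV" "f \<in> A"
  shows "Phi A f = const_proj f"
proof -
  have "taylor_coeff A f = (\<lambda>j. const_proj ((taylor_rest ^^ j) f))"
    unfolding taylor_coeff_def
    by (rule the_equality) (use assms in \<open>auto intro!: taylor_expansion_exists taylor_expansion_unique\<close>)
  then show ?thesis by (simp add: Phi_def)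
qed

section \<open>Bases of the constants\<close>

lemma coeff_const_proj_monom_reduced:
  "b \<in> reduced \<Longrightarrow> coeff (const_proj (monom s)) b = (if b = s then 1 else 0)"
  by (simp add: coeff_const_proj_reduced coeff_monom)

lemma inj_on_const_proj_monom: "inj_on (\<lambda>s. const_proj (monom s) :: 'k::field_char_0 nas) reduced"
proof (rule inj_onI)
  fix s t :: word
  assume "s \<in> reduced" "t \<in> reduced" and eq: "const_proj (monom s) = (const_proj (monom t) :: 'k nas)"
  then have "coeff (const_proj (monom t) :: 'k nas) s = 1"
    by (simp add: coeff_const_proj_monom_reduced flip: eq)
  then show "s = t" using \<open>s \<in> reduced\<close> by (simp add: coeff_const_proj_monom_reduced split: if_splits)
qed

text \<open>Reading off the coefficient at a reduced word \<open>s\<close> isolates the scalar of \<open>\<Phi>(s)\<close> in a linear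
  relation.\<close>

lemma independent_const_proj_monom:
  assumes "S \<subseteq> reduced"
  shows "nas.independent ((\<lambda>s. const_proj (monom s) :: 'k::field_char_0 nas) ` S)"
  unfolding nas.dependent_explicit
proof (intro notI, elim exE conjE bexE)
  let ?e = "\<lambda>s. const_proj (monom s) :: 'k nas"
  fix T u w
  assume T: "finite T" "T \<subseteq> ?e ` S" "(\<Sum>v\<in>T. scale (u v) v) = 0"
    and w: "w \<in> T" "u w \<noteq> 0"
  obtain s where ws: "w = ?e s" "s \<in> S" using T(2) w(1) by blast
  with w have s: "?e s \<in> T" "u (?e s) \<noteq> 0" "s \<in> S" by simp_all
  have "u v * coeff v s = (if v = ?e s then u (?e s) else 0)" if v: "v \<in> T" for v
  proof -
    obtain t where t: "v = ?e t" "t \<in> S" using T(2) v by blast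
    have st: "s \<in> reduced" "t \<in> reduced" using s(3) t(2) assms by auto
    have "?e t = ?e s \<longleftrightarrow> t = s" by (rule inj_on_eq_iff[OF inj_on_const_proj_monom st(2,1)])
    then show ?thesis using st(1) by (auto simp: t(1) coeff_const_proj_monom_reduced)
  qed
  then have "coeff (\<Sum>v\<in>T. scale (u v) v) s = u (?e s)"
    using T(1) s(1) by (simp cong: sum.cong)
  with T(3) s(2) show False by simp
qed

text \<open>This is \<open>f = \<Phi>(f)\<close> with \<open>f\<close> expanded into words; the words that are not reduced drop out because
  the projection kills them.\<close>

lemma const_expansion:
  fixes f :: "'k::field_char_0 nas"
  assumes "ddx f = 0"
  shows "coeff f b = (\<Sum>s | s \<in> reduced \<and> wdeg s = wdeg b. coeff f s * coeff (const_proj (monom s)) b)"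
proof -
  have nonreduced: "const_proj (monom s) = (0 :: 'k nas)" if s: "s \<notin> reduced" for s
  proof -
    obtain w where w: "s = wmul (Some X) w" using s by (auto simp: reduced_def)
    have "monom s = (lmul_x (monom w) :: 'k nas)" by (simp add: w lmul_x_def monom_mult)
    then show ?thesis by (simp only: const_proj_lmul_x)
  qed
  have "coeff f b = (\<Sum>s | wdeg s = wdeg b. coeff f s * coeff (const_proj (monom s)) b)"
    using coeff_const_proj_monom_expansion[of f b] by (simp add: const_proj_const assms)
  also have "\<dots> = (\<Sum>s | s \<in> reduced \<and> wdeg s = wdeg b. coeff f s * coeff (const_proj (monom s)) b)"
    by (rule sum.mono_neutral_right[OF finite_wdeg]) (use nonreduced in force)+
  finally show ?thesis .
qed

lemma const_proj_monom_homogeneous: "const_proj (monom s :: 'k::field_char_0 nas) \<in> homogeneous (wdeg s)"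
  using monom_homogeneous[of s, where ?'a='k] unfolding homogeneous_iff
  by (auto intro: vanishes_at_const_proj)

lemma coeff_const_proj_monom_wdeg:
  "wdeg s \<noteq> wdeg b \<Longrightarrow> coeff (const_proj (monom s :: 'k::field_char_0 nas)) b = 0"
  using const_proj_monom_homogeneous[of s, where ?'k='k] by (auto simp: homogeneous_def)

text \<open>Stated for an arbitrary finite set of reduced words that covers the reduced part of the support, so that it
  applies both to all polynomials and to a single degree.\<close>

lemma const_in_span:
  fixes f :: "'k::field_char_0 nas"
  assumes "ddx f = 0" "finite S" "S \<subseteq> reduced" "\<And>s. s \<in> reduced \<Longrightarrow> coeff f s \<noteq> 0 \<Longrightarrow> s \<in> S"
  shows "f \<in> nas.span ((\<lambda>s. const_proj (monom s)) ` S)"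
proof -
  have "f = (\<Sum>s\<in>S. scale (coeff f s) (const_proj (monom s)))"
  proof (rule const_eqI)
    fix b assume b: "b \<in> reduced"
    then have "coeff f s * coeff (const_proj (monom s) :: 'k nas) b = (if s = b then coeff f b else 0)" for s
      by (simp add: coeff_const_proj_monom_reduced)
    then show "coeff f b = coeff (\<Sum>s\<in>S. scale (coeff f s) (const_proj (monom s))) b"
      using assms(2,4) b by auto
  qed (simp_all add: assms(1) ddx.sum ddx.scale ddx_const_proj)
  also have "\<dots> \<in> nas.span ((\<lambda>s. const_proj (monom s)) ` S)"
    by (intro nas.span_sum nas.span_scale nas.span_base imageI)
  finally show ?thesis .
qed

lemma subspace_A0_polys: "nas.subspace (A0 polys :: 'k::field nas set)"
proof (rule nas.subspaceI)
  show "0 \<in> (A0 polys :: 'k nas set)" by (simp add: A0_def polys_def)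
next
  fix f g :: "'k nas" assume fg: "f \<in> A0 polys" "g \<in> A0 polys"
  have "{b. coeff (f + g) b \<noteq> 0} \<subseteq> {b. coeff f b \<noteq> 0} \<union> {b. coeff g b \<noteq> 0}" by auto
  moreover have "finite ({b. coeff f b \<noteq> 0} \<union> {b. coeff g b \<noteq> 0})"
    using fg by (simp add: A0_def polys_def)
  ultimately have "finite {b. coeff (f + g) b \<noteq> 0}" by (rule finite_subset)
  with fg show "f + g \<in> A0 polys" by (simp add: A0_def polys_def ddx_add)
next
  fix c and f :: "'k nas" assume f: "f \<in> A0 polys"
  have "{b. coeff (scale c f) b \<noteq> 0} \<subseteq> {b. coeff f b \<noteq> 0}" by auto
  moreover have "finite {b. coeff f b \<noteq> 0}" using f by (simp add: A0_def polys_def)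
  ultimately have "finite {b. coeff (scale c f) b \<noteq> 0}" by (rule finite_subset)
  with f show "scale c f \<in> A0 polys" by (simp add: A0_def polys_def ddx_scale)
qed

lemma span_const_proj_monom:
  "nas.span ((\<lambda>s. const_proj (monom s)) ` reduced) = (A0 polys :: 'k::field_char_0 nas set)"
proof (rule nas.span_subspace)
  show "(\<lambda>s. const_proj (monom s)) ` reduced \<subseteq> (A0 polys :: 'k nas set)"
    by (auto simp: A0_def ddx_const_proj intro!: homogeneous_imp_polys const_proj_monom_homogeneous)
  show "A0 polys \<subseteq> nas.span ((\<lambda>s. const_proj (monom s) :: 'k nas) ` reduced)"
  proof
    fix f :: "'k nas" assume "f \<in> A0 polys"
    then have f: "ddx f = 0" "finite {b. coeff f b \<noteq> 0}" by (auto simp: A0_def polys_def)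
    then have "f \<in> nas.span ((\<lambda>s. const_proj (monom s)) ` (reduced \<inter> {b. coeff f b \<noteq> 0}))"
      by (intro const_in_span) auto
    then show "f \<in> nas.span ((\<lambda>s. const_proj (monom s)) ` reduced)"
      by (rule set_mp[OF nas.span_mono[OF image_mono[OF Int_lower1]]])
  qed
qed (rule subspace_A0_polys)

lemma series_sum_cong:
  assumes "\<And>s. s \<in> S \<Longrightarrow> F s = G s"
  shows "series_sum S F f = series_sum S G f"
proof -
  have "{s \<in> S. coeff (F s) b \<noteq> 0} = {s \<in> S. coeff (G s) b \<noteq> 0}" for b
    using assms by auto
  moreover have "(\<Sum>s | s \<in> S \<and> coeff (F s) b \<noteq> 0. coeff (F s) b)
      = (\<Sum>s | s \<in> S \<and> coeff (G s) b \<noteq> 0. coeff (G s) b)" for b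
    by (rule sum.cong) (use assms in auto)
  ultimately show ?thesis by (simp only: series_sum_def)
qed

lemma series_sum_const_proj_monom:
  fixes f :: "'k::field_char_0 nas"
  assumes "ddx f = 0"
  shows "series_sum reduced (\<lambda>s. scale (coeff f s) (const_proj (monom s))) f"
  unfolding series_sum_def
proof (intro allI conjI)
  fix b
  let ?F = "\<lambda>s. coeff (scale (coeff f s) (const_proj (monom s))) b"
  let ?R = "{s. s \<in> reduced \<and> wdeg s = wdeg b}"
  have fin: "finite ?R" using finite_wdeg[of "wdeg b"] by simp
  have sub: "{s \<in> reduced. ?F s \<noteq> 0} \<subseteq> ?R" using coeff_const_proj_monom_wdeg by fastforce
  show "finite {s \<in> reduced. ?F s \<noteq> 0}" using sub fin by (rule finite_subset)
  have "coeff f b = sum ?F ?R" using const_expansion[OF assms, of b] by simp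
  also have "\<dots> = sum ?F {s \<in> reduced. ?F s \<noteq> 0}"
    using fin sub by (rule sum.mono_neutral_right) auto
  finally show "coeff f b = sum ?F {s \<in> reduced. ?F s \<noteq> 0}" .
qed

text \<open>This gives the uniqueness of coordinates: they are coefficients of \<open>f\<close>.\<close>

lemma series_sum_coeff_reduced:
  fixes f :: "'k::field_char_0 nas"
  assumes "series_sum reduced (\<lambda>s. scale (c s) (const_proj (monom s))) f" "b \<in> reduced"
  shows "coeff f b = c b"
proof -
  have "{s \<in> reduced. coeff (scale (c s) (const_proj (monom s))) b \<noteq> 0} = (if c b = 0 then {} else {b})"
    using assms(2) by (auto simp: coeff_const_proj_monom_reduced)
  then show ?thesis using assms
    by (auto simp: series_sum_def coeff_const_proj_monom_reduced)
qed

lemma series_basis_const_proj_monom: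
  "series_basis reduced (\<lambda>s. const_proj (monom s)) (A0 UNIV :: 'k::field_char_0 nas set)"
  unfolding series_basis_def
proof (intro conjI allI ballI)
  fix c :: "word \<Rightarrow> 'k"
  \<comment> \<open>The projection does not change coefficients at reduced words, so this constant has the
    prescribed coordinates.\<close>
  let ?f = "const_proj (Series c)"
  have "series_sum reduced (\<lambda>s. scale (coeff ?f s) (const_proj (monom s))) ?f"
    by (rule series_sum_const_proj_monom) (rule ddx_const_proj)
  moreover have "coeff ?f s = c s" if "s \<in> reduced" for s
    using that by (simp add: coeff_const_proj_reduced)
  ultimately have "series_sum reduced (\<lambda>s. scale (c s) (const_proj (monom s))) ?f"
    by (simp cong: series_sum_cong)
  then show "\<exists>f\<in>A0 UNIV. series_sum reduced (\<lambda>s. scale (c s) (const_proj (monom s))) f"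
    by (intro bexI[of _ ?f]) (simp_all add: A0_def ddx_const_proj)
next
  fix f :: "'k nas" assume "f \<in> A0 UNIV"
  then have f: "ddx f = 0" by (simp add: A0_def)
  let ?c = "\<lambda>s. if s \<in> reduced then coeff f s else 0"
  show "\<exists>!c. (\<forall>s. s \<notin> reduced \<longrightarrow> c s = 0) \<and> series_sum reduced (\<lambda>s. scale (c s) (const_proj (monom s))) f"
  proof (rule ex1I[of _ ?c])
    show "(\<forall>s. s \<notin> reduced \<longrightarrow> ?c s = 0) \<and> series_sum reduced (\<lambda>s. scale (?c s) (const_proj (monom s))) f"
      using series_sum_const_proj_monom[OF f] by (simp cong: series_sum_cong)
  next
    fix c assume c: "(\<forall>s. s \<notin> reduced \<longrightarrow> c s = 0)
      \<and> series_sum reduced (\<lambda>s. scale (c s) (const_proj (monom s))) f"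
    then have "c s = coeff f s" if "s \<in> reduced" for s
      using series_sum_coeff_reduced[of c f s] that by simp
    with c show "c = ?c" by (simp add: fun_eq_iff)
  qed
qed

section \<open>Counting trees\<close>

lemma catalan_Suc: "catalan (Suc n) = fact (2 * n) / (fact (Suc n) * fact n)"
  by (simp add: catalan_def)

lemma catalan_step:
  "(of_nat n + 2) * catalan (n + 2) = 2 * (2 * of_nat n + 1) * catalan (n + 1)"
proof -
  define a f F where "a = (of_nat n :: rat)" and "f = (fact (2 * n) :: rat)" and "F = (fact n :: rat)"
  have nz: "a + 1 \<noteq> 0" "a + 2 \<noteq> 0" "F \<noteq> 0"
    using of_nat_0_le_iff[of n, where ?'a = rat] unfolding a_def[symmetric] by (auto simp: F_def)
  have "fact (2 * Suc n) = 2 * (a + 1) * ((2 * a + 1) * f)"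
    by (simp add: a_def f_def algebra_simps)
  moreover have "fact (Suc n) = (a + 1) * F" "fact (Suc (Suc n)) = (a + 2) * ((a + 1) * F)"
    by (simp_all add: a_def F_def algebra_simps)
  ultimately have eqs: "catalan (n + 2) = 2 * (a + 1) * ((2 * a + 1) * f) / ((a + 2) * ((a + 1) * F) * ((a + 1) * F))"
    "catalan (n + 1) = f / ((a + 1) * F * F)"
    using catalan_Suc[of "Suc n"] catalan_Suc[of n] by (simp_all only: f_def F_def add_2_eq_Suc' Suc_eq_plus1[symmetric])
  show ?thesis unfolding a_def[symmetric] eqs using nz by (simp add: divide_simps) (simp add: algebra_simps)
qed

text \<open>The Catalan recurrence for the closed formula, by Gosper summation: each summand is a
  difference \<open>g (i + 1) - g i\<close> of a hypergeometric term \<open>g\<close>.  In terms of the central binomial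
  coefficients \<open>B i = (i + 1) * catalan (i + 1)\<close>, the term is
  \<open>g i = B i * B (n + 1 - i) * (2 * i - n - 1) / (2 * (n + 1) * (n + 2))\<close>.\<close>

lemma catalan_convolution:
  "(\<Sum>i\<le>n. catalan (i + 1) * catalan (n - i + 1)) = catalan (n + 2)"
proof -
  define d :: rat where "d = 2 * (of_nat n + 1) * (of_nat n + 2)"
  define g :: "nat \<Rightarrow> rat" where
    "g i = (of_nat i + 1) * catalan (i + 1) * ((of_nat n + 2 - of_nat i) * catalan (n + 2 - i))
       * (2 * of_nat i - of_nat n - 1) / d" for i
  have nz: "of_nat n + 1 \<noteq> (0 :: rat)" "of_nat n + 2 \<noteq> (0 :: rat)"
    using of_nat_0_le_iff[of n, where ?'a = rat] by linarith+
  then have d: "d \<noteq> 0" by (simp add: d_def)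
  have step: "g (Suc i) - g i = catalan (i + 1) * catalan (n - i + 1)" if i: "i \<le> n" for i
  proof -
    obtain j where n: "n = i + j" using i le_Suc_ex by blast
    have idx: "n + 2 - i = j + 2" "n + 2 - Suc i = j + 1" "n - i + 1 = j + 1" "Suc i + 1 = i + 2"
      using n by auto
    define a b p q where "a = (of_nat i :: rat)" and "b = (of_nat j :: rat)"
      and "p = catalan (i + 1)" and "q = catalan (j + 1)"
    have n': "of_nat n = a + b" by (simp add: n a_def b_def)
    have "g (Suc i) = ((a + 2) * catalan (i + 2)) * ((b + 1) * q) * (a - b + 1) / d"
      unfolding g_def idx n' q_def[symmetric] by (simp add: a_def[symmetric] algebra_simps)
    also have "(a + 2) * catalan (i + 2) = 2 * (2 * a + 1) * p"
      unfolding a_def p_def by (rule catalan_step)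
    finally have g1: "g (Suc i) = 2 * (2 * a + 1) * p * ((b + 1) * q) * (a - b + 1) / d" .
    have "g i = (a + 1) * p * ((b + 2) * catalan (j + 2)) * (a - b - 1) / d"
      unfolding g_def idx n' p_def[symmetric] by (simp add: a_def[symmetric] algebra_simps)
    also have "(b + 2) * catalan (j + 2) = 2 * (2 * b + 1) * q"
      unfolding b_def q_def by (rule catalan_step)
    finally have "g (Suc i) - g i = (2 * (2 * a + 1) * p * ((b + 1) * q) * (a - b + 1)
        - (a + 1) * p * (2 * (2 * b + 1) * q) * (a - b - 1)) / d"
      unfolding g1 by (simp only: diff_divide_distrib)
    also have "2 * (2 * a + 1) * p * ((b + 1) * q) * (a - b + 1)
        - (a + 1) * p * (2 * (2 * b + 1) * q) * (a - b - 1) = p * q * d"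
      unfolding d_def n' by algebra
    also have "p * q * d / d = p * q" using d by simp
    finally show ?thesis unfolding idx p_def q_def .
  qed
  have "(\<Sum>i\<le>n. catalan (i + 1) * catalan (n - i + 1)) = (\<Sum>i<Suc n. g (Suc i) - g i)"
    using step by (intro sum.cong) auto
  also have "\<dots> = g (Suc n) - g 0" by (rule sum_lessThan_telescope)
  \<comment> \<open>The term \<open>g\<close> is odd under \<open>i \<mapsto> n + 1 - i\<close>, so the two ends contribute equally.\<close>
  also have "\<dots> = catalan (n + 2)"
  proof -
    have c1: "catalan (Suc 0) = 1" by (simp add: catalan_def)
    have "g (Suc n) = (of_nat n + 2) * catalan (n + 2) * (of_nat n + 1) / d"
      unfolding g_def by (simp add: c1 algebra_simps)
    moreover have "g 0 = - ((of_nat n + 2) * catalan (n + 2) * (of_nat n + 1) / d)"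
      unfolding g_def by (simp add: c1 minus_divide_left algebra_simps)
    ultimately have "g (Suc n) - g 0 = ((of_nat n + 2) * catalan (n + 2) * (of_nat n + 1)
        + (of_nat n + 2) * catalan (n + 2) * (of_nat n + 1)) / d"
      by (simp only: diff_minus_eq_add add_divide_distrib)
    also have "(of_nat n + 2) * catalan (n + 2) * (of_nat n + 1)
        + (of_nat n + 2) * catalan (n + 2) * (of_nat n + 1) = catalan (n + 2) * d"
      unfolding d_def by algebra
    finally show ?thesis using d by simp
  qed
  finally show ?thesis .
qed

lemma finite_deg: "finite {t. deg t = n}"
  by (rule finite_subset[OF _ finite_deg_le[of n]]) auto

lemma card_deg: "of_nat (card {t. deg t = Suc n}) = catalan (Suc n)"
proof (induction n rule: less_induct)
  case (less n)
  show ?case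
  proof (cases n)
    case 0
    have "t = X" if "deg t = 1" for t
      using that by (cases t) (auto simp: add_is_1 less_imp_neq[OF deg_pos, symmetric])
    then have "{t. deg t = 1} = {X}" by auto
    then show ?thesis using 0 by (simp add: catalan_def)
  next
    case (Suc m)
    let ?D = "\<lambda>i. {t. deg t = Suc i}"
    let ?P = "\<lambda>i. ?D i \<times> ?D (m - i)"
    have eq: "?D n = (\<lambda>(u, v). u \<bullet> v) ` (\<Union>i\<le>m. ?P i)"
    proof (intro set_eqI iffI)
      fix t assume t: "t \<in> ?D n"
      then obtain u v where uv: "t = u \<bullet> v" using Suc by (cases t) auto
      obtain i j where "deg u = Suc i" "deg v = Suc j"
        using deg_pos[of u] deg_pos[of v] gr0_implies_Suc by metis
      then show "t \<in> (\<lambda>(u, v). u \<bullet> v) ` (\<Union>i\<le>m. ?P i)"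
        using t uv Suc by (intro image_eqI[of _ _ "(u, v)"]) auto
    qed (use Suc in auto)
    have "card (?D n) = card (\<Union>i\<le>m. ?P i)"
      unfolding eq by (rule card_image) (auto simp: inj_on_def)
    also have "\<dots> = (\<Sum>i\<le>m. card (?P i))"
      by (rule card_UN_disjoint) (auto simp: finite_deg)
    finally have "of_nat (card (?D n)) = (\<Sum>i\<le>m. of_nat (card (?D i)) * of_nat (card (?D (m - i))) :: rat)"
      by (simp add: card_cartesian_product)
    also have "\<dots> = (\<Sum>i\<le>m. catalan (i + 1) * catalan (m - i + 1))"
      using Suc less.IH by (intro sum.cong) auto
    finally show ?thesis using Suc by (simp only: catalan_convolution) simp
  qed
qed

text \<open>The words of degree \<open>n\<close> are the reduced ones together with \<open>x \<cdot> w\<close> for the words \<open>w\<close> of degree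
  \<open>n - 1\<close>.  In degree 0 there is exactly the unit word, which is why the value
  \<open>catalan 0 = 1\<close> is the right one for \<open>n = 1\<close>.\<close>

lemma card_reduced:
  assumes "n \<ge> 1"
  shows "of_nat (card {s \<in> reduced. wdeg s = n}) = catalan n - catalan (n - 1)"
proof -
  have split: "{s. wdeg s = Suc m} = {s \<in> reduced. wdeg s = Suc m} \<union> wmul (Some X) ` {s. wdeg s = m}" for m
    by (auto simp: reduced_def)
  have inj: "inj (wmul (Some X))"
    by (rule inj_on_inverseI[where g = "\<lambda>b. case b of Some (u \<bullet> v) \<Rightarrow> Some v | _ \<Rightarrow> None"])
      (auto split: option.splits magma.splits elim!: wmul.elims)
  have words: "of_nat (card {s. wdeg s = m}) = catalan m" for m
  proof (cases m)
    case 0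
    have "{s. wdeg s = 0} = {None}"
      using deg_pos by (auto split: option.splits) (metis less_irrefl not_Some_eq wdeg.simps(2))
    then show ?thesis using 0 by (simp add: catalan_def)
  next
    case (Suc k)
    have "{s. wdeg s = Suc k} = Some ` {t. deg t = Suc k}"
    proof (intro set_eqI)
      show "s \<in> {s. wdeg s = Suc k} \<longleftrightarrow> s \<in> Some ` {t. deg t = Suc k}" for s by (cases s) auto
    qed
    then show ?thesis using Suc by (simp add: card_image card_deg)
  qed
  obtain m where m: "n = Suc m" using assms by (cases n) auto
  have "card {s. wdeg s = Suc m} = card {s \<in> reduced. wdeg s = Suc m} + card (wmul (Some X) ` {s. wdeg s = m})"
    by (subst split, rule card_Un_disjoint) (auto simp: finite_wdeg reduced_def)
  also have "card (wmul (Some X) ` {s. wdeg s = m}) = card {s. wdeg s = m}"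
    by (rule card_image) (rule inj_on_subset[OF inj subset_UNIV])
  finally have "(of_nat (card {s. wdeg s = Suc m}) :: rat)
      = of_nat (card {s \<in> reduced. wdeg s = Suc m}) + of_nat (card {s. wdeg s = m})"
    by simp
  then show ?thesis using words[of m] words[of "Suc m"] m by simp
qed

section \<open>Homogeneous components\<close>

lemma subspace_A0_homogeneous: "nas.subspace (A0 UNIV \<inter> homogeneous n :: 'k::field nas set)"
  by (rule nas.subspaceI)
    (auto simp: A0_def homogeneous_iff vanishes_at_def ddx_add ddx_scale)

text \<open>Homogeneous series have finite support, so the component of degree \<open>n\<close> is the same for
  polynomials and for series.\<close>

lemma span_const_proj_monom_homogeneous:
  "nas.span ((\<lambda>s. const_proj (monom s)) ` {s \<in> reduced. wdeg s = n})
    = (A0 UNIV \<inter> homogeneous n :: 'k::field_char_0 nas set)"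
proof (rule nas.span_subspace)
  show "(\<lambda>s. const_proj (monom s)) ` {s \<in> reduced. wdeg s = n} \<subseteq> (A0 UNIV \<inter> homogeneous n :: 'k nas set)"
    by (auto simp: A0_def ddx_const_proj intro!: const_proj_monom_homogeneous)
  show "A0 UNIV \<inter> homogeneous n
      \<subseteq> nas.span ((\<lambda>s. const_proj (monom s) :: 'k nas) ` {s \<in> reduced. wdeg s = n})"
  proof
    fix f :: "'k nas" assume "f \<in> A0 UNIV \<inter> homogeneous n"
    then have f: "ddx f = 0" "\<And>b. coeff f b \<noteq> 0 \<Longrightarrow> wdeg b = n" by (auto simp: A0_def homogeneous_def)
    show "f \<in> nas.span ((\<lambda>s. const_proj (monom s)) ` {s \<in> reduced. wdeg s = n})"
      by (rule const_in_span) (use f in \<open>auto simp: finite_wdeg\<close>)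
  qed
qed (rule subspace_A0_homogeneous)

theorem proposition2p9:
  fixes A :: "'k::field_char_0 nas set"
  assumes "A = polys \<or> A = UNIV"
  shows "(\<forall>s\<in>Gamma. Phi A (monom (Some s)) \<in> polys \<inter> homogeneous (deg s))
    \<and> Phi A 1 = 1
    \<and> (A = polys \<longrightarrow>
         inj_on (\<lambda>s. Phi A (monom s)) (insert None (Some ` Gamma))
       \<and> nas.independent ((\<lambda>s. Phi A (monom s)) ` insert None (Some ` Gamma))
       \<and> nas.span ((\<lambda>s. Phi A (monom s)) ` insert None (Some ` Gamma)) = A0 A)
    \<and> (A = UNIV \<longrightarrow>
         series_basis (insert None (Some ` Gamma)) (\<lambda>s. Phi A (monom s)) (A0 A))
    \<and> (\<forall>n\<ge>1.
         (\<exists>B. finite B \<and> nas.span B = A0 A \<inter> homogeneous n)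
       \<and> of_nat (nas.dim (A0 A \<inter> homogeneous n)) = catalan n - catalan (n - 1))"
proof -
  have Phi: "Phi A (monom s) = const_proj (monom s)" for s
    using assms by (intro Phi_eq_const_proj) (auto intro: homogeneous_imp_polys monom_homogeneous)
  have "Phi A 1 = 1"
    unfolding one_nas_def Phi by (rule const_proj_const) (simp add: ddx_monom)
  moreover have "Phi A (monom (Some s)) \<in> polys \<inter> homogeneous (deg s)" for s
    using const_proj_monom_homogeneous[of "Some s", where ?'k = 'k]
    by (auto simp: Phi intro: homogeneous_imp_polys)
  moreover have "(\<exists>B. finite B \<and> nas.span B = A0 A \<inter> homogeneous n)
      \<and> of_nat (nas.dim (A0 A \<inter> homogeneous n)) = catalan n - catalan (n - 1)" if n: "n \<ge> 1" for n
  proof -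
    let ?R = "{s \<in> reduced. wdeg s = n}"
    let ?B = "(\<lambda>s. const_proj (monom s) :: 'k nas) ` ?R"
    have "A0 A \<inter> homogeneous n = A0 UNIV \<inter> homogeneous n"
      using assms by (auto simp: A0_def intro: homogeneous_imp_polys)
    then have span: "nas.span ?B = A0 A \<inter> homogeneous n"
      by (simp add: span_const_proj_monom_homogeneous)
    have "nas.dim (A0 A \<inter> homogeneous n) = card ?B"
      unfolding span[symmetric] nas.dim_span
      by (rule nas.dim_eq_card_independent) (rule independent_const_proj_monom, blast)
    also have "\<dots> = card ?R"
      by (rule card_image) (rule inj_on_subset[OF inj_on_const_proj_monom], blast)
    finally have "of_nat (nas.dim (A0 A \<inter> homogeneous n)) = catalan n - catalan (n - 1)"
      by (simp only: card_reduced[OF n])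
    moreover have "finite ?B" by (simp add: finite_wdeg)
    ultimately show ?thesis using span by blast
  qed
  moreover have "inj_on (\<lambda>s. Phi A (monom s)) reduced
      \<and> nas.independent ((\<lambda>s. Phi A (monom s)) ` reduced)
      \<and> nas.span ((\<lambda>s. Phi A (monom s)) ` reduced) = A0 A" if "A = polys"
    unfolding Phi unfolding that span_const_proj_monom
    by (intro conjI inj_on_const_proj_monom independent_const_proj_monom subset_refl refl)
  moreover have "series_basis reduced (\<lambda>s. Phi A (monom s)) (A0 A)" if "A = UNIV"
    unfolding Phi unfolding that by (rule series_basis_const_proj_monom)
  ultimately show ?thesis
    unfolding reduced_eq[symmetric] by blast
qed

end
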